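(* Let $G$ be a finite Abelian group and $k$ an integer, both varying along a sequence, such that $k\gg\log|G|$ with $|G|\to\infty$. Write $\rho:=\log k/\log\log|G|$. Then $$\max_{L\in\mathbb{N}} t_0\bigl(L,|G/LG|\bigr)\sim t_0(\infty,|G|)\sim \tfrac{\rho}{\rho-1}\log_k|G| = \log(|G|)\big/\log\bigl(k/\log|G|\bigr).$$
   Context: Asymptotic notation: $a\gg b$ means $b/a\to0$; $a\sim b$ means $a/b\to1$. $\log$ is the natural logarithm and $\log_k x=\log x/\log k$. For an Abelian group $G$ (written additively), $LG:=\{Lx:x\in G\}$. The walk is either the rate-1 simple random walk (jumps $\pm1$ with probability $1/2$ each) or the rate-1 directed random walk (jumps $+1$), started at $0$, on $\mathbb{Z}_L$ (jumps taken mod $L$), or on $\mathbb{Z}$ when $L=\infty$. $H_L(s)$ is the Shannon entropy (natural logarithm) of its position at time $s$; for $2\le L\le\infty$, $H_L$ is a strictly increasing bijection from $[0,\infty)$ to $[0,\log L)$ (to $[0,\infty)$ if $L=\infty$). For $L\in\mathbb{N}\cup\{\infty\}$ and $N\in\mathbb{N}$ the entropic time (with $k$ coordinates) is $$t_0(L,N):=k\,H_L^{-1}\bigl((\log N)/k\bigr).$$ The trivial case $L=1$ (where $H_1\equiv0$ and $|G/LG|=1$) is given the value $0$. The statement holds for both walks. *)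

theory Defs
  imports
    "HOL-Probability.Probability"
    "HOL-Library.Landau_Symbols"
    "HOL-Library.Extended_Nat"
    "HOL-Algebra.Coset"
begin

datatype walk = Simple | Directed

fun jump_pmf :: "walk \<Rightarrow> int pmf" where
  "jump_pmf Simple = pmf_of_set {-1, 1}"
| "jump_pmf Directed = return_pmf 1"

text \<open>For finite \<open>L \<ge> 1\<close> the elements of \<open>\<int>\<^sub>L\<close> are represented by \<open>0, \<dots>, L - 1\<close>.
  The value \<open>L = 0\<close> is never used.\<close>

fun reduce :: "enat \<Rightarrow> int \<Rightarrow> int" where
  "reduce (enat L) x = x mod int L"
| "reduce \<infinity> x = x"

fun steps_pmf :: "walk \<Rightarrow> enat \<Rightarrow> nat \<Rightarrow> int pmf" where
  "steps_pmf w L 0 = return_pmf 0"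
| "steps_pmf w L (Suc m) =
     bind_pmf (steps_pmf w L m) (\<lambda>x. map_pmf (\<lambda>j. reduce L (x + j)) (jump_pmf w))"

text \<open>A rate-1 walk has made a Poisson number of jumps, of mean \<open>s\<close>, by time \<open>s\<close>.
  The library constant \<^const>\<open>poisson_pmf\<close> is only meaningful for a positive mean, so
  time \<open>0\<close> is treated separately.\<close>

definition num_jumps_pmf :: "real \<Rightarrow> nat pmf" where
  "num_jumps_pmf s = (if s = 0 then return_pmf 0 else poisson_pmf s)"

definition position_pmf :: "walk \<Rightarrow> enat \<Rightarrow> real \<Rightarrow> int pmf" where
  "position_pmf w L s = bind_pmf (num_jumps_pmf s) (steps_pmf w L)"

definition shannon_entropy :: "'a :: countable pmf \<Rightarrow> real" where
  "shannon_entropy p = prob_space.entropy (measure_pmf p) (exp 1) (count_space UNIV) (\<lambda>x. x)"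

lemma shannon_entropy_eq:
  "shannon_entropy p = - (\<integral>x. pmf p x * ln (pmf p x) \<partial>count_space UNIV)"
proof -
  interpret information_space "measure_pmf p" "exp 1"
    by (auto simp: information_space_def information_space_axioms_def prob_space_measure_pmf)
  have "distr (measure_pmf p) (count_space UNIV) (\<lambda>x. x) = measure_pmf p"
    by (rule distr_id2) simp
  then have "distributed (measure_pmf p) (count_space UNIV) (\<lambda>x. x) (\<lambda>x. ennreal (pmf p x))"
    by (simp add: distributed_def measure_pmf_eq_density[symmetric])
  from entropy_distr[OF this] show ?thesis
    by (simp add: shannon_entropy_def log_def)
qed

definition H :: "walk \<Rightarrow> enat \<Rightarrow> real \<Rightarrow> real" where
  "H w L s = shannon_entropy (position_pmf w L s)"

definition t0 :: "walk \<Rightarrow> nat \<Rightarrow> enat \<Rightarrow> nat \<Rightarrow> real" where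
  "t0 w k L N = (if L = 1 then 0 else real k * inv_into {0..} (H w L) (ln (real N) / real k))"

text \<open>The subgroup written \<open>LG\<close> in additive notation.\<close>

definition multiples :: "('a, 'b) monoid_scheme \<Rightarrow> nat \<Rightarrow> 'a set" where
  "multiples G L = (\<lambda>x. x [^]\<^bsub>G\<^esub> L) ` carrier G"

definition t0_quotient :: "walk \<Rightarrow> nat \<Rightarrow> ('a, 'b) monoid_scheme \<Rightarrow> nat \<Rightarrow> real" where
  "t0_quotient w k G L = t0 w k (enat L) (order (G Mod multiples G L))"

end

theory Submission
  imports
    Defs
    "HOL-Real_Asymp.Real_Asymp"
    "HOL-Algebra.Multiplicative_Group"
begin

text \<open>
  Since \<open>k \<ggreater> log |G|\<close>, the entropy per coordinate \<open>y = log |G| / k\<close> tends to \<open>0\<close>, so only the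
  behaviour of \<open>H\<^sub>L\<close> at small times matters, and there it is the same for every \<open>L \<ge> 2\<close>. By a small
  time \<open>s\<close> the walk has most likely not moved; it has moved with probability \<open>\<sim> s\<close>, and the
  surprisal of having moved is about \<open>log (1 / s)\<close>. Hence \<open>H\<^sub>L s \<sim> s log (1 / s)\<close>, the
  inverse is \<open>\<sim> y / log (1 / y)\<close>, and \<open>k y / log (1 / y)\<close> is exactly
  \<open>log |G| / log (k / log |G|)\<close>.

  Two one-sided bounds make this precise. The lower bound on \<open>H\<^sub>L\<close> (\<open>H_lower\<close>) is uniform in
  \<open>L \<ge> 2\<close>, so it bounds all \<open>t\<^sub>0(L, |G/LG|)\<close> above at once, because \<open>|G/LG| \<le> |G|\<close>.
  The upper bound (\<open>H_upper\<close>) concerns the walk on \<open>\<int>\<close>. It bounds \<open>t\<^sub>0(\<infinity>, |G|)\<close> below, and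
  \<open>L = |G|\<close> then bounds the maximum below: here \<open>LG\<close> is trivial, and \<open>H\<^sub>L \<le> H\<^sub>\<infinity>\<close> gives
  \<open>t\<^sub>0(\<infinity>, |G|) \<le> t\<^sub>0(|G|, |G|)\<close>.

  To pass from bounds on \<open>H\<^sub>L\<close> to bounds on its inverse, \<open>H\<^sub>L\<close> has to be monotone and
  continuous. Both come from the law of the position at time \<open>s + t\<close> being a convolution: adding an
  independent increment cannot decrease entropy (\<open>ent_combine_ge\<close>), and it increases it by at most
  the entropy of the increment (\<open>H_add_le\<close>), which tends to \<open>0\<close> with \<open>t\<close>.

  That the supremum over \<open>L\<close> is attained comes from \<open>H\<^sub>L s \<longlonglongrightarrow> H\<^sub>\<infinity> s\<close> (\<open>H_finite_tendsto\<close>)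
  and from \<open>H\<^sub>\<infinity>\<close> being strictly increasing: any value above \<open>t\<^sub>0(\<infinity>, |G|)\<close> dominates all
  those with \<open>L\<close> large, and if there is no such value, then \<open>L = |G|\<close> is a maximiser.
\<close>

section \<open>Entropy of discrete distributions\<close>

text \<open>
  Entropy is handled as the expected surprisal. A Bochner integral of a non-integrable function is
  \<open>0\<close>, so every comparison of entropies has to come with a proof that they are finite.
\<close>

abbreviation ent :: "'a pmf \<Rightarrow> real" where
  "ent p \<equiv> measure_pmf.expectation p (\<lambda>x. - ln (pmf p x))"

abbreviation finite_ent :: "'a pmf \<Rightarrow> bool" where
  "finite_ent p \<equiv> integrable (measure_pmf p) (\<lambda>x. - ln (pmf p x))"

lemma shannon_entropy_expectation:
  fixes p :: "'a :: countable pmf"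
  shows "shannon_entropy p = ent p"
  unfolding shannon_entropy_eq measure_pmf_eq_density[of p]
  by (subst integral_density) auto

lemma ln_pmf_nonpos: "ln (pmf p x) \<le> 0"
proof (cases "pmf p x = 0")
  case False
  then show ?thesis
    using pmf_le_1[of p x] pmf_nonneg[of p x] by simp
qed simp

lemma ent_nonneg: "0 \<le> ent p"
  by (rule Bochner_Integration.integral_nonneg) (use ln_pmf_nonpos in auto)

lemma ent_return [simp]: "ent (return_pmf a) = 0"
  by (simp add: integral_return)

lemma nn_integral_ratio_le:
  fixes r :: "'a \<Rightarrow> real"
  assumes "\<And>x. 0 \<le> r x"
  shows "(\<integral>\<^sup>+ x. ennreal (r x / pmf p x) \<partial>measure_pmf p) \<le> (\<integral>\<^sup>+ x. ennreal (r x) \<partial>count_space (set_pmf p))"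
proof -
  have "(\<integral>\<^sup>+ x. ennreal (r x / pmf p x) \<partial>measure_pmf p)
      = (\<integral>\<^sup>+ x. ennreal (pmf p x) * ennreal (r x / pmf p x) \<partial>count_space UNIV)"
    by (rule nn_integral_measure_pmf)
  also have "\<dots> \<le> (\<integral>\<^sup>+ x. ennreal (r x) * indicator (set_pmf p) x \<partial>count_space UNIV)"
    by (intro nn_integral_mono)
       (auto simp: ennreal_mult[symmetric] assms set_pmf_iff split: split_indicator)
  also have "\<dots> = (\<integral>\<^sup>+ x. ennreal (r x) \<partial>count_space (set_pmf p))"
    by (simp add: nn_integral_count_space_indicator)
  finally show ?thesis .
qed

lemma ln_ratio_le:
  fixes a b :: real
  assumes "0 < a" "0 < b"
  shows "- ln a \<le> - ln b + b / a - 1"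
proof -
  have "ln (b / a) \<le> b / a - 1"
    using assms by (intro ln_le_minus_one) auto
  then show ?thesis
    using assms by (simp add: ln_div)
qed

text \<open>
  Gibbs' inequality, from \<open>ln u \<le> u - 1\<close>, for weights \<open>r\<close> of total mass at most \<open>R\<close>. The weights are
  not normalised, so that an upper bound for an entropy needs no exact normalising constant.
\<close>

lemma gibbs:
  fixes r :: "'a \<Rightarrow> real"
  assumes pos: "\<And>x. 0 < r x"
    and mass: "(\<integral>\<^sup>+ x. ennreal (r x) \<partial>count_space UNIV) \<le> ennreal R" and "0 \<le> R"
    and int: "integrable (measure_pmf p) (\<lambda>x. - ln (r x))"
  shows "finite_ent p"
    and "ent p \<le> measure_pmf.expectation p (\<lambda>x. - ln (r x)) + R - 1"
proof -
  have nn: "(\<integral>\<^sup>+ x. ennreal (r x / pmf p x) \<partial>measure_pmf p) \<le> ennreal R"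
  proof -
    have "(\<integral>\<^sup>+ x. ennreal (r x) \<partial>count_space (set_pmf p)) \<le> (\<integral>\<^sup>+ x. ennreal (r x) \<partial>count_space UNIV)"
      by (subst nn_integral_count_space_indicator)
         (auto intro!: nn_integral_mono split: split_indicator)
    then show ?thesis
      using nn_integral_ratio_le[of r p] pos mass by (meson less_imp_le order_trans)
  qed
  have int_ratio: "integrable (measure_pmf p) (\<lambda>x. r x / pmf p x)"
    by (rule integrableI_nonneg)
       (use pos nn in \<open>auto simp: less_imp_le order_le_less_trans[OF nn]\<close>)
  have E_ratio: "measure_pmf.expectation p (\<lambda>x. r x / pmf p x) \<le> R"
    by (subst integral_eq_nn_integral)
       (use pos nn \<open>0 \<le> R\<close> in \<open>auto simp: less_imp_le intro!: enn2real_leI\<close>)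
  have int_bound: "integrable (measure_pmf p) (\<lambda>x. - ln (r x) + r x / pmf p x - 1)"
    using int int_ratio by auto
  have le: "AE x in measure_pmf p. - ln (pmf p x) \<le> - ln (r x) + r x / pmf p x - 1"
    unfolding AE_measure_pmf_iff using pos by (blast intro: ln_ratio_le pmf_positive)
  show fin: "finite_ent p"
  proof (rule Bochner_Integration.integrable_bound[OF int_bound])
    show "AE x in measure_pmf p. norm (- ln (pmf p x)) \<le> norm (- ln (r x) + r x / pmf p x - 1)"
      using le by eventually_elim (use ln_pmf_nonpos in \<open>smt (verit) real_norm_def\<close>)
  qed auto
  have "ent p \<le> measure_pmf.expectation p (\<lambda>x. - ln (r x) + r x / pmf p x - 1)"
    by (rule integral_mono_AE[OF fin int_bound le])
  also have "\<dots> = measure_pmf.expectation p (\<lambda>x. - ln (r x)) + measure_pmf.expectation p (\<lambda>x. r x / pmf p x) - 1"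
    using int int_ratio by simp
  finally show "ent p \<le> measure_pmf.expectation p (\<lambda>x. - ln (r x)) + R - 1"
    using E_ratio by simp
qed

lemma pmf_le_pmf_map: "pmf p x \<le> pmf (map_pmf f p) (f x)"
  unfolding pmf_map unfolding pmf.rep_eq
  by (rule measure_pmf.finite_measure_mono) auto

lemma ln_pmf_le_ln_pmf_map: "x \<in> set_pmf p \<Longrightarrow> - ln (pmf (map_pmf f p) (f x)) \<le> - ln (pmf p x)"
  using pmf_le_pmf_map[of p x f] by (simp add: pmf_positive)

text \<open>
  Data processing: merging atoms makes the observed atom more likely, so it lowers the surprisal
  pointwise.
\<close>

lemma ent_map_le:
  assumes "finite_ent p"
  shows "finite_ent (map_pmf f p)" and "ent (map_pmf f p) \<le> ent p"
proof -
  have le: "AE x in measure_pmf p. - ln (pmf (map_pmf f p) (f x)) \<le> - ln (pmf p x)"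
    by (simp add: AE_measure_pmf_iff ln_pmf_le_ln_pmf_map del: neg_le_iff_le)
  have int: "integrable (measure_pmf p) (\<lambda>x. - ln (pmf (map_pmf f p) (f x)))"
  proof (rule Bochner_Integration.integrable_bound[OF assms])
    show "AE x in measure_pmf p. norm (- ln (pmf (map_pmf f p) (f x))) \<le> norm (- ln (pmf p x))"
      using le by eventually_elim (use ln_pmf_nonpos in \<open>smt (verit) real_norm_def\<close>)
  qed auto
  then show "finite_ent (map_pmf f p)"
    unfolding map_pmf_rep_eq by (subst integrable_distr_eq) (auto simp: map_pmf_rep_eq)
  show "ent (map_pmf f p) \<le> ent p"
    unfolding integral_map_pmf by (rule integral_mono_AE[OF int assms le])
qed

lemma integrable_pair_pmf_fst:
  fixes f :: "'a \<Rightarrow> real"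
  shows "integrable (measure_pmf p) f \<Longrightarrow> integrable (measure_pmf (pair_pmf p q)) (\<lambda>z. f (fst z))"
  by (subst (asm) map_fst_pair_pmf[of p q, symmetric]) (simp add: map_pmf_rep_eq integrable_distr_eq)

lemma integrable_pair_pmf_snd:
  fixes f :: "'b \<Rightarrow> real"
  shows "integrable (measure_pmf q) f \<Longrightarrow> integrable (measure_pmf (pair_pmf p q)) (\<lambda>z. f (snd z))"
  by (subst (asm) map_snd_pair_pmf[of p q, symmetric]) (simp add: map_pmf_rep_eq integrable_distr_eq)

lemma ent_pair:
  assumes "finite_ent p" "finite_ent q"
  shows "finite_ent (pair_pmf p q)" and "ent (pair_pmf p q) = ent p + ent q"
proof -
  note int = integrable_pair_pmf_fst[OF assms(1), of q] integrable_pair_pmf_snd[OF assms(2), of p]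
  have eq: "AE z in measure_pmf (pair_pmf p q).
      - ln (pmf (pair_pmf p q) z) = - ln (pmf p (fst z)) + - ln (pmf q (snd z))"
    unfolding AE_measure_pmf_iff by (auto simp: pmf_pair ln_mult set_pmf_iff)
  have "integrable (measure_pmf (pair_pmf p q)) (\<lambda>z. - ln (pmf p (fst z)) + - ln (pmf q (snd z)))"
    using int by (rule Bochner_Integration.integrable_add)
  then show "finite_ent (pair_pmf p q)"
    by (subst integrable_cong_AE[OF _ _ eq]) auto
  have "ent (pair_pmf p q) = measure_pmf.expectation (pair_pmf p q) (\<lambda>z. - ln (pmf p (fst z)) + - ln (pmf q (snd z)))"
    using eq by (intro integral_cong_AE) auto
  also have "\<dots> = measure_pmf.expectation (pair_pmf p q) (\<lambda>z. - ln (pmf p (fst z)))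
      + measure_pmf.expectation (pair_pmf p q) (\<lambda>z. - ln (pmf q (snd z)))"
    using int by (rule Bochner_Integration.integral_add)
  finally show "ent (pair_pmf p q) = ent p + ent q"
    unfolding expectation_pair_pmf_fst[of p q "\<lambda>x. - ln (pmf p x)"]
      expectation_pair_pmf_snd[of p q "\<lambda>x. - ln (pmf q x)"] .
qed

text \<open>
  If \<open>f\<close> is injective in its first argument, then \<open>f X Y\<close> with \<open>X\<close> and \<open>Y\<close> independent has at least
  the entropy of \<open>X\<close>. Writing \<open>u\<close> for the mass of \<open>f X Y\<close> under its own law \<open>r\<close>, the gap between the
  entropies is the expectation of \<open>ln (p X / u) \<ge> 1 - u / p X\<close>; summing first over the values of \<open>X\<close>,
  injectivity makes the expectation of \<open>u / p X\<close> at most \<open>1\<close>. Equality in \<open>ln v \<le> v - 1\<close> forces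
  \<open>v = 1\<close>, which gives the equality case.
\<close>

lemma ent_combine_ge:
  fixes f :: "'a \<Rightarrow> 'b \<Rightarrow> 'c"
  defines "r p q \<equiv> map_pmf (\<lambda>z. f (fst z) (snd z)) (pair_pmf p q)"
  assumes inj: "\<And>y. y \<in> set_pmf q \<Longrightarrow> inj_on (\<lambda>x. f x y) (set_pmf p)"
    and fin: "finite_ent p" "finite_ent q"
  shows "ent p \<le> ent (r p q)"
    and "\<lbrakk>ent (r p q) = ent p; x \<in> set_pmf p; y \<in> set_pmf q\<rbrakk> \<Longrightarrow> pmf (r p q) (f x y) = pmf p x"
proof -
  define u where "u z = pmf (r p q) (f (fst z) (snd z))" for z
  define J where "J = pair_pmf p q"
  have rJ: "r p q = map_pmf (\<lambda>z. f (fst z) (snd z)) J"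
    by (simp add: r_def J_def)
  have u_pos: "0 < u z" if "z \<in> set_pmf J" for z
    using that unfolding u_def rJ by (auto intro!: pmf_positive)
  have p_pos: "0 < pmf p (fst z)" if "z \<in> set_pmf J" for z
    using that by (auto simp: J_def intro!: pmf_positive)
  have inn: "(\<integral>\<^sup>+ x. ennreal (pmf (r p q) (f x y) / pmf p x) \<partial>measure_pmf p) \<le> 1" if "y \<in> set_pmf q" for y
  proof -
    have "(\<integral>\<^sup>+ x. ennreal (pmf (r p q) (f x y) / pmf p x) \<partial>measure_pmf p)
        \<le> (\<integral>\<^sup>+ x. ennreal (pmf (r p q) (f x y)) \<partial>count_space (set_pmf p))"
      by (rule nn_integral_ratio_le) simp
    also have "\<dots> = emeasure (measure_pmf (r p q)) ((\<lambda>x. f x y) ` set_pmf p)"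
      using inj[OF that] by (rule nn_integral_pmf')
    also have "\<dots> \<le> 1"
      by (rule measure_pmf.emeasure_le_1)
    finally show ?thesis .
  qed
  have nn: "(\<integral>\<^sup>+ z. ennreal (u z / pmf p (fst z)) \<partial>measure_pmf J) \<le> 1"
  proof -
    have "(\<integral>\<^sup>+ z. ennreal (u z / pmf p (fst z)) \<partial>measure_pmf J)
        = (\<integral>\<^sup>+ y. \<integral>\<^sup>+ x. ennreal (pmf (r p q) (f x y) / pmf p x) \<partial>measure_pmf p \<partial>measure_pmf q)"
      unfolding J_def pair_commute_pmf[of p q] by (simp add: nn_integral_pair_pmf' u_def)
    also have "\<dots> \<le> (\<integral>\<^sup>+ y. 1 \<partial>measure_pmf q)"
      by (rule nn_integral_mono_AE) (simp add: AE_measure_pmf_iff inn)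
    finally show ?thesis by simp
  qed
  have int_ratio: "integrable (measure_pmf J) (\<lambda>z. u z / pmf p (fst z))"
    by (rule integrableI_nonneg)
       (auto simp: u_def[symmetric] order_le_less_trans[OF nn], simp add: u_def)
  have E_ratio: "measure_pmf.expectation J (\<lambda>z. u z / pmf p (fst z)) \<le> 1"
    by (subst integral_eq_nn_integral)
       (use nn in \<open>auto simp: u_def intro!: enn2real_leI\<close>)
  have int_p: "integrable (measure_pmf J) (\<lambda>z. - ln (pmf p (fst z)))"
    unfolding J_def by (rule integrable_pair_pmf_fst[OF fin(1)])
  have int_u: "integrable (measure_pmf J) (\<lambda>z. - ln (u z))"
  proof -
    have "finite_ent (r p q)"
      unfolding r_def by (rule ent_map_le(1)[OF ent_pair(1)[OF fin]])
    then show ?thesis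
      unfolding rJ map_pmf_rep_eq by (subst (asm) integrable_distr_eq) (auto simp: map_pmf_rep_eq u_def rJ)
  qed
  \<comment> \<open>the integrand of the entropy gap, after subtracting \<open>1 - u / p X\<close>\<close>
  define g where "g z = - ln (u z) + u z / pmf p (fst z) - 1 - (- ln (pmf p (fst z)))" for z
  have int_g: "integrable (measure_pmf J) g"
    unfolding g_def using int_u int_p int_ratio by auto
  have g_nonneg: "AE z in measure_pmf J. 0 \<le> g z"
    unfolding AE_measure_pmf_iff g_def
    using ln_ratio_le[OF p_pos u_pos] by force
  have ent_r: "ent (r p q) = measure_pmf.expectation J (\<lambda>z. - ln (u z))"
    unfolding rJ integral_map_pmf u_def ..
  have ent_p: "ent p = measure_pmf.expectation J (\<lambda>z. - ln (pmf p (fst z)))"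
    unfolding J_def by (rule expectation_pair_pmf_fst[symmetric])
  have E_g: "measure_pmf.expectation J g
      = ent (r p q) + measure_pmf.expectation J (\<lambda>z. u z / pmf p (fst z)) - 1 - ent p"
    unfolding g_def ent_r ent_p using int_u int_p int_ratio by simp
  show "ent p \<le> ent (r p q)"
    using integral_nonneg_AE[OF g_nonneg] E_g E_ratio by linarith
  show "pmf (r p q) (f x y) = pmf p x"
    if eq: "ent (r p q) = ent p" and x: "x \<in> set_pmf p" and y: "y \<in> set_pmf q"
  proof -
    have "measure_pmf.expectation J g = 0"
      using integral_nonneg_AE[OF g_nonneg] E_g E_ratio eq by linarith
    then have "AE z in measure_pmf J. g z = 0"
      using integral_nonneg_eq_0_iff_AE[OF int_g g_nonneg] by simp
    then have "g (x, y) = 0"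
      using x y by (auto simp: AE_measure_pmf_iff J_def)
    moreover have "(x, y) \<in> set_pmf J"
      using x y by (simp add: J_def)
    note p_pos[OF this] u_pos[OF this]
    ultimately have "ln (u (x, y) / pmf p x) = u (x, y) / pmf p x - 1" "0 < u (x, y) / pmf p x" "0 < pmf p x"
      by (auto simp: g_def ln_div)
    then have "u (x, y) / pmf p x = 1" and "0 < pmf p x"
      by (blast intro: ln_eq_minus_one)+
    then show ?thesis
      by (simp add: u_def)
  qed
qed

section \<open>The law of the position\<close>

lemma reduce_reduce_add [simp]: "reduce L (reduce L x + y) = reduce L (x + y)"
  by (cases L) (simp_all add: mod_add_left_eq)

lemma reduce_add_reduce [simp]: "reduce L (x + reduce L y) = reduce L (x + y)"
  using reduce_reduce_add[of L y x] by (simp add: add.commute)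

lemma reduce_0 [simp]: "reduce L 0 = 0"
  by (cases L) simp_all

lemma steps_pmf_reduce: "steps_pmf w L m = map_pmf (reduce L) (steps_pmf w \<infinity> m)"
  by (induction m)
     (simp_all add: map_bind_pmf bind_map_pmf pmf.map_comp o_def)

lemma position_pmf_reduce: "position_pmf w L s = map_pmf (reduce L) (position_pmf w \<infinity> s)"
  unfolding position_pmf_def map_bind_pmf steps_pmf_reduce[of w L, symmetric] ..

lemma position_pmf_0 [simp]: "position_pmf w L 0 = return_pmf 0"
  by (simp add: position_pmf_def num_jumps_pmf_def bind_return_pmf)

abbreviation sum_pmf :: "'a pmf \<Rightarrow> 'a pmf \<Rightarrow> 'a :: plus pmf" where
  "sum_pmf p q \<equiv> map_pmf (\<lambda>z. fst z + snd z) (pair_pmf p q)"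

lemma steps_pmf_Suc_infinity: "steps_pmf w \<infinity> (Suc m) = sum_pmf (steps_pmf w \<infinity> m) (jump_pmf w)"
  by (simp add: pair_pmf_def map_bind_pmf map_pmf_def bind_assoc_pmf bind_return_pmf)

lemma sum_pmf_assoc: "sum_pmf (sum_pmf p q) r = sum_pmf p (sum_pmf q r)"
  for p q r :: "'a :: semigroup_add pmf"
  by (simp add: pair_pmf_def map_bind_pmf map_pmf_def bind_assoc_pmf bind_return_pmf add.assoc)

lemma steps_pmf_add: "steps_pmf w \<infinity> (m + n) = sum_pmf (steps_pmf w \<infinity> m) (steps_pmf w \<infinity> n)"
proof (induction n)
  case 0
  then show ?case by (simp add: pair_return_pmf2 pmf.map_comp o_def)
next
  case (Suc n)
  then show ?case
    unfolding add_Suc_right steps_pmf_Suc_infinity by (simp only: sum_pmf_assoc)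
qed

lemma poisson_pmf_add:
  assumes "0 < s" "0 < t"
  shows "sum_pmf (poisson_pmf s) (poisson_pmf t) = poisson_pmf (s + t)"
proof (rule pmf_eqI)
  fix n :: nat
  have "pmf (sum_pmf (poisson_pmf s) (poisson_pmf t)) n
      = (\<Sum>z\<in>{z. fst z + snd z = n}. pmf (pair_pmf (poisson_pmf s) (poisson_pmf t)) z)"
  proof -
    have "finite {z :: nat \<times> nat. fst z + snd z = n}"
      by (rule finite_subset[of _ "{..n} \<times> {..n}"]) auto
    then show ?thesis
      unfolding pmf_map by (subst measure_measure_pmf_finite[symmetric]) (auto simp: vimage_def)
  qed
  also have "\<dots> = (\<Sum>i\<le>n. pmf (poisson_pmf s) i * pmf (poisson_pmf t) (n - i))"
    by (rule sum.reindex_bij_witness[of _ "\<lambda>i. (i, n - i)" fst]) (auto simp: pmf_pair)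
  also have "\<dots> = (\<Sum>i\<le>n. of_nat (n choose i) * s ^ i * t ^ (n - i)) / fact n * exp (- (s + t))"
    unfolding sum_divide_distrib sum_distrib_right
    by (intro sum.cong refl) (use assms in \<open>simp add: binomial_fact exp_add[symmetric] field_simps exp_diff exp_minus\<close>)
  also have "\<dots> = pmf (poisson_pmf (s + t)) n"
    using assms by (simp add: binomial_ring[of s t n])
  finally show "pmf (sum_pmf (poisson_pmf s) (poisson_pmf t)) n = pmf (poisson_pmf (s + t)) n" .
qed

lemma num_jumps_pmf_add:
  assumes "0 \<le> s" "0 \<le> t"
  shows "num_jumps_pmf (s + t) = sum_pmf (num_jumps_pmf s) (num_jumps_pmf t)"
proof (cases "s = 0 \<or> t = 0")
  case True
  then show ?thesis
    by (auto simp: num_jumps_pmf_def pair_return_pmf1 pair_return_pmf2 pmf.map_comp o_def)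
next
  case False
  then show ?thesis
    using assms poisson_pmf_add[of s t] by (simp add: num_jumps_pmf_def)
qed

lemma position_pmf_add_infinity:
  assumes "0 \<le> s" "0 \<le> t"
  shows "position_pmf w \<infinity> (s + t) = sum_pmf (position_pmf w \<infinity> s) (position_pmf w \<infinity> t)"
proof -
  have "position_pmf w \<infinity> (s + t) = bind_pmf (num_jumps_pmf s) (\<lambda>m. bind_pmf (num_jumps_pmf t)
      (\<lambda>n. bind_pmf (steps_pmf w \<infinity> m) (\<lambda>x. bind_pmf (steps_pmf w \<infinity> n) (\<lambda>y. return_pmf (x + y)))))"
    using assms
    by (simp add: position_pmf_def num_jumps_pmf_add pair_pmf_def map_pmf_def bind_assoc_pmf bind_return_pmf
        steps_pmf_add del: steps_pmf.simps)
  also have "\<dots> = bind_pmf (num_jumps_pmf s) (\<lambda>m. bind_pmf (steps_pmf w \<infinity> m) (\<lambda>x. bind_pmf (num_jumps_pmf t)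
      (\<lambda>n. bind_pmf (steps_pmf w \<infinity> n) (\<lambda>y. return_pmf (x + y)))))"
    by (subst bind_commute_pmf[of "num_jumps_pmf t"]) (rule refl)
  also have "\<dots> = sum_pmf (position_pmf w \<infinity> s) (position_pmf w \<infinity> t)"
    by (simp add: position_pmf_def pair_pmf_def map_pmf_def bind_assoc_pmf bind_return_pmf)
  finally show ?thesis .
qed

text \<open>
  The semigroup property. It holds on \<open>\<int>\<close> because sums of independent Poisson variables are Poisson,
  and it passes to \<open>\<int>\<^sub>L\<close> by reduction.
\<close>

lemma position_pmf_add:
  assumes "0 \<le> s" "0 \<le> t"
  shows "position_pmf w L (s + t)
       = map_pmf (\<lambda>z. reduce L (fst z + snd z)) (pair_pmf (position_pmf w L s) (position_pmf w L t))"
  unfolding position_pmf_reduce[of w L] position_pmf_add_infinity[OF assms]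
  by (simp add: map_pair[symmetric] pmf.map_comp o_def case_prod_unfold)

lemma set_position_pmf: "set_pmf (position_pmf w L s) \<subseteq> range (reduce L)"
  by (subst position_pmf_reduce) auto

lemma inj_on_reduce_add: "inj_on (\<lambda>x. reduce L (x + y)) (range (reduce L))"
proof (rule inj_onI)
  fix a b assume "a \<in> range (reduce L)" "b \<in> range (reduce L)" and eq: "reduce L (a + y) = reduce L (b + y)"
  then obtain a' b' where ab: "a = reduce L a'" "b = reduce L b'" by auto
  have "reduce L (reduce L (a + y) + (- y)) = reduce L (reduce L (b + y) + (- y))"
    using eq by simp
  then have "reduce L a = reduce L b"
    unfolding reduce_reduce_add by simp
  then show "a = b"
    using reduce_reduce_add[of L a' 0] reduce_reduce_add[of L b' 0] by (simp add: ab)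
qed

lemma jump_abs: "j \<in> set_pmf (jump_pmf w) \<Longrightarrow> \<bar>j\<bar> = 1"
  by (cases w) auto

lemma steps_abs_le: "x \<in> set_pmf (steps_pmf w \<infinity> m) \<Longrightarrow> \<bar>x\<bar> \<le> int m"
proof (induction m arbitrary: x)
  case (Suc m)
  then obtain y j where "y \<in> set_pmf (steps_pmf w \<infinity> m)" "j \<in> set_pmf (jump_pmf w)" "x = y + j"
    by auto
  then show ?case
    using Suc.IH[of y] jump_abs[of j w] by linarith
qed simp

lemma num_jumps_mean:
  assumes "0 \<le> s"
  shows "(\<integral>\<^sup>+ n. ennreal (real n) \<partial>measure_pmf (num_jumps_pmf s)) = ennreal s"
proof (cases "s = 0")
  case True
  then show ?thesis by (simp add: num_jumps_pmf_def)
next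
  case False
  then have s: "0 < s" using assms by simp
  have "(\<lambda>n. s ^ n / fact n) sums exp s"
    using exp_converges[of s] by (simp add: field_simps scaleR_conv_of_real)
  then have "(\<lambda>n. s ^ n / fact n * (s * exp (- s))) sums (exp s * (s * exp (- s)))"
    by (rule sums_mult2)
  then have "(\<lambda>n. s ^ Suc n / fact (Suc n) * exp (- s) * real (Suc n)) sums s"
    by (simp add: field_simps exp_minus del: of_nat_Suc)
  then have sums: "(\<lambda>n. s ^ n / fact n * exp (- s) * real n) sums s"
    by (subst (asm) sums_Suc_iff) simp
  have "(\<integral>\<^sup>+ n. ennreal (real n) \<partial>measure_pmf (num_jumps_pmf s))
      = (\<Sum>n. ennreal (s ^ n / fact n * exp (- s) * real n))"
    using s by (simp add: num_jumps_pmf_def nn_integral_measure_pmf nn_integral_count_space_nat ennreal_mult[symmetric] ac_simps)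
  also have "\<dots> = ennreal s"
    using sums s by (intro suminf_ennreal_eq) auto
  finally show ?thesis .
qed

text \<open>
  The displacement is at most the number of jumps, whose mean is \<open>s\<close>. This single moment bound
  gives finite entropy, the upper bound on the entropy, and, by Markov's inequality, the bound \<open>s\<close> on
  the probability of having moved.
\<close>

lemma position_abs_mean:
  assumes "0 \<le> s"
  shows "integrable (measure_pmf (position_pmf w \<infinity> s)) (\<lambda>x. real_of_int \<bar>x\<bar>)"
    and "measure_pmf.expectation (position_pmf w \<infinity> s) (\<lambda>x. real_of_int \<bar>x\<bar>) \<le> s"
proof -
  have "(\<integral>\<^sup>+ x. ennreal (real_of_int \<bar>x\<bar>) \<partial>measure_pmf (position_pmf w \<infinity> s))
      = (\<integral>\<^sup>+ n. \<integral>\<^sup>+ x. ennreal (real_of_int \<bar>x\<bar>) \<partial>measure_pmf (steps_pmf w \<infinity> n) \<partial>measure_pmf (num_jumps_pmf s))"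
    by (simp add: position_pmf_def)
  also have "\<dots> \<le> (\<integral>\<^sup>+ n. ennreal (real n) \<partial>measure_pmf (num_jumps_pmf s))"
  proof (rule nn_integral_mono)
    fix n
    have "(\<integral>\<^sup>+ x. ennreal (real_of_int \<bar>x\<bar>) \<partial>measure_pmf (steps_pmf w \<infinity> n))
        \<le> (\<integral>\<^sup>+ x. ennreal (real n) \<partial>measure_pmf (steps_pmf w \<infinity> n))"
      using steps_abs_le[of _ w n]
      by (intro nn_integral_mono_AE) (fastforce simp: AE_measure_pmf_iff intro!: ennreal_leI)
    then show "(\<integral>\<^sup>+ x. ennreal (real_of_int \<bar>x\<bar>) \<partial>measure_pmf (steps_pmf w \<infinity> n)) \<le> ennreal (real n)"
      by simp
  qed
  finally have nn: "(\<integral>\<^sup>+ x. ennreal (real_of_int \<bar>x\<bar>) \<partial>measure_pmf (position_pmf w \<infinity> s)) \<le> ennreal s"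
    by (simp add: num_jumps_mean assms)
  show "integrable (measure_pmf (position_pmf w \<infinity> s)) (\<lambda>x. real_of_int \<bar>x\<bar>)"
    by (rule integrableI_nonneg) (auto simp: order_le_less_trans[OF nn, simplified])
  show "measure_pmf.expectation (position_pmf w \<infinity> s) (\<lambda>x. real_of_int \<bar>x\<bar>) \<le> s"
    by (subst integral_eq_nn_integral) (use nn assms in \<open>auto intro!: enn2real_leI\<close>)
qed

section \<open>The entropy of the position as a function of time\<close>

lemma exp_abs_mass_finite: "(\<integral>\<^sup>+ x. ennreal (exp (- real_of_int \<bar>x\<bar>)) \<partial>count_space UNIV) < \<infinity>"
proof -
  have nat: "(\<integral>\<^sup>+ n. ennreal (exp (- real n)) \<partial>count_space UNIV) < \<infinity>"
  proof -
    have "summable (\<lambda>n. exp (- 1 :: real) ^ n)"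
      by (rule summable_geometric) simp
    then have "summable (\<lambda>n. exp (- real n))"
      by (simp add: exp_of_nat_mult[symmetric])
    then have "(\<Sum>n. ennreal (exp (- real n))) < \<infinity>"
      by (subst suminf_ennreal2) auto
    then show ?thesis
      by (simp add: nn_integral_count_space_nat)
  qed
  let ?w = "\<lambda>x :: int. ennreal (exp (- real_of_int \<bar>x\<bar>))"
  have half: "(\<integral>\<^sup>+ x. ?w x \<partial>count_space (range f)) < \<infinity>" if "inj f" "\<And>n. \<bar>f n\<bar> = int n" for f
    using nat nn_integral_bij_count_space[OF inj_on_imp_bij_betw[OF that(1)], of ?w] that(2)
    by (simp)
  have "(\<integral>\<^sup>+ x. ?w x \<partial>count_space UNIV)
      \<le> (\<integral>\<^sup>+ x. ?w x * indicator (range int) x + ?w x * indicator (range (\<lambda>n. - int n)) x \<partial>count_space UNIV)"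
  proof (rule nn_integral_mono)
    fix x :: int
    have "x \<in> range int \<or> x \<in> range (\<lambda>n. - int n)"
      by (cases x rule: int_cases2) auto
    then show "?w x \<le> ?w x * indicator (range int) x + ?w x * indicator (range (\<lambda>n. - int n)) x"
      by (auto split: split_indicator)
  qed
  also have "\<dots> = (\<integral>\<^sup>+ x. ?w x \<partial>count_space (range int)) + (\<integral>\<^sup>+ x. ?w x \<partial>count_space (range (\<lambda>n. - int n)))"
    by (subst nn_integral_add) (simp_all add: nn_integral_count_space_indicator)
  also have "\<dots> < \<infinity>"
    using half[of int] half[of "\<lambda>n. - int n"] by (simp add: inj_def)
  finally show ?thesis .
qed

text \<open>
  Gibbs' inequality with weight \<open>1\<close> at the origin and \<open>c * exp (- \<bar>x\<bar>)\<close> elsewhere. The origin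
  contributes no surprisal, and all the excess mass is proportional to \<open>c\<close>. Taking \<open>c = 1\<close> gives
  finiteness; taking \<open>c\<close> of the order of the mean makes the bound sharp to leading order.
\<close>

lemma ent_mean_bound:
  obtains C where "0 \<le> C"
    and "\<And>(p :: int pmf) c. \<lbrakk>integrable (measure_pmf p) (\<lambda>x. real_of_int \<bar>x\<bar>); 0 < c; c \<le> 1\<rbrakk>
      \<Longrightarrow> finite_ent p \<and> ent p \<le> (ln (1 / c) + 1) * measure_pmf.expectation p (\<lambda>x. real_of_int \<bar>x\<bar>) + C * c"
proof -
  obtain C where C: "0 \<le> C" "(\<integral>\<^sup>+ x. ennreal (exp (- real_of_int \<bar>x\<bar>)) \<partial>count_space UNIV) = ennreal C"
    using exp_abs_mass_finite by (auto simp: less_top[symmetric] elim!: ennreal_cases)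
  have "finite_ent p \<and> ent p \<le> (ln (1 / c) + 1) * measure_pmf.expectation p (\<lambda>x. real_of_int \<bar>x\<bar>) + C * c"
    if mean: "integrable (measure_pmf p) (\<lambda>x. real_of_int \<bar>x\<bar>)" and c: "0 < c" "c \<le> 1"
    for p :: "int pmf" and c :: real
  proof -
    define r where "r x = (if x = 0 then 1 else c * exp (- real_of_int \<bar>x\<bar>))" for x :: int
    have r_pos: "0 < r x" for x
      using c by (simp add: r_def)
    have mass: "(\<integral>\<^sup>+ x. ennreal (r x) \<partial>count_space UNIV) \<le> ennreal (1 + C * c)"
    proof -
      have "(\<integral>\<^sup>+ x. ennreal (r x) \<partial>count_space UNIV)
          \<le> (\<integral>\<^sup>+ x. indicator {0} x + ennreal c * ennreal (exp (- real_of_int \<bar>x\<bar>)) \<partial>count_space UNIV)"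
        by (rule nn_integral_mono) (use c in \<open>auto simp: r_def ennreal_mult split: split_indicator\<close>)
      also have "\<dots> = 1 + ennreal c * ennreal C"
        by (subst nn_integral_add) (auto simp: nn_integral_cmult C(2)[simplified])
      also have "\<dots> = ennreal (1 + C * c)"
        using c C(1) by (simp add: ennreal_mult ennreal_plus mult.commute)
      finally show ?thesis .
    qed
    \<comment> \<open>for \<open>x \<noteq> 0\<close> the surprisal \<open>ln (1 / c) + \<bar>x\<bar>\<close> is at most linear in \<open>\<bar>x\<bar>\<close>, as \<open>1 \<le> \<bar>x\<bar>\<close>\<close>
    have ln_r: "\<bar>ln (r x)\<bar> \<le> (ln (1 / c) + 1) * real_of_int \<bar>x\<bar>" "ln (r x) \<le> 0" for x
    proof -
      show "ln (r x) \<le> 0"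
        using c r_pos[of x] by (auto simp: r_def intro!: mult_le_one)
      moreover have "- ln (r x) \<le> (ln (1 / c) + 1) * real_of_int \<bar>x\<bar>"
      proof (cases "x = 0")
        case False
        then have "1 \<le> real_of_int \<bar>x\<bar>" by linarith
        then have "ln (1 / c) * 1 \<le> ln (1 / c) * real_of_int \<bar>x\<bar>"
          using c by (intro mult_left_mono) auto
        then show ?thesis
          using False c by (simp add: r_def ln_mult ln_div algebra_simps)
      qed (simp add: r_def)
      ultimately show "\<bar>ln (r x)\<bar> \<le> (ln (1 / c) + 1) * real_of_int \<bar>x\<bar>" by linarith
    qed
    have int_bound: "integrable (measure_pmf p) (\<lambda>x. (ln (1 / c) + 1) * real_of_int \<bar>x\<bar>)"
      using mean by (rule integrable_mult_right)
    have int_r: "integrable (measure_pmf p) (\<lambda>x. - ln (r x))"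
      by (rule Bochner_Integration.integrable_bound[OF int_bound])
         (use ln_r(1) in \<open>auto intro!: AE_I2 order_trans[OF _ abs_ge_self]\<close>)
    have R: "0 \<le> 1 + C * c"
      using c C by simp
    have "measure_pmf.expectation p (\<lambda>x. - ln (r x)) \<le> measure_pmf.expectation p (\<lambda>x. (ln (1 / c) + 1) * real_of_int \<bar>x\<bar>)"
      by (rule integral_mono[OF int_r int_bound]) (use ln_r in \<open>smt (verit)\<close>)
    then show ?thesis
      using gibbs[of r, OF r_pos mass R int_r] by simp
  qed
  with C(1) show ?thesis by (rule that)
qed

lemma H_eq_ent: "H w L s = ent (position_pmf w L s)"
  by (simp add: H_def shannon_entropy_expectation)

lemma finite_ent_position:
  assumes "0 \<le> s"
  shows "finite_ent (position_pmf w L s)"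
proof -
  have "finite_ent (position_pmf w \<infinity> s)"
    using ent_mean_bound position_abs_mean(1)[OF assms] by (metis zero_less_one order_refl)
  then show ?thesis
    by (subst (1 2) position_pmf_reduce) (rule ent_map_le(1))
qed

lemma H_0 [simp]: "H w L 0 = 0"
  by (simp add: H_eq_ent)

lemma H_le_infinity: "0 \<le> s \<Longrightarrow> H w L s \<le> H w \<infinity> s"
  unfolding H_eq_ent by (subst (1 2) position_pmf_reduce[of w L]) (rule ent_map_le(2)[OF finite_ent_position])

lemma H_upper:
  obtains C where "0 \<le> C" and "\<And>w s. \<lbrakk>0 < s; s \<le> 1\<rbrakk> \<Longrightarrow> H w \<infinity> s \<le> s * ln (1 / s) + C * s"
proof -
  obtain C where C: "0 \<le> C"
    "\<And>(p :: int pmf) c. \<lbrakk>integrable (measure_pmf p) (\<lambda>x. real_of_int \<bar>x\<bar>); 0 < c; c \<le> 1\<rbrakk>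
      \<Longrightarrow> finite_ent p \<and> ent p \<le> (ln (1 / c) + 1) * measure_pmf.expectation p (\<lambda>x. real_of_int \<bar>x\<bar>) + C * c"
    using ent_mean_bound by blast
  show ?thesis
  proof (rule that[of "C + 1"])
    fix w and s :: real
    assume s: "0 < s" "s \<le> 1"
    have "H w \<infinity> s \<le> (ln (1 / s) + 1) * measure_pmf.expectation (position_pmf w \<infinity> s) (\<lambda>x. real_of_int \<bar>x\<bar>) + C * s"
      using C(2)[OF position_abs_mean(1) s] s by (simp add: H_eq_ent)
    also have "\<dots> \<le> (ln (1 / s) + 1) * s + C * s"
      using position_abs_mean(2)[of s w] s by (intro add_right_mono mult_left_mono) auto
    finally show "H w \<infinity> s \<le> s * ln (1 / s) + (C + 1) * s"
      by (simp add: algebra_simps)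
  qed (use C in simp)
qed

lemma H_mono_add:
  assumes "0 \<le> s" "0 \<le> t"
  shows "H w L s \<le> H w L (s + t)"
  unfolding H_eq_ent position_pmf_add[OF assms]
  by (rule ent_combine_ge(1)[where f = "\<lambda>x y. reduce L (x + y)"])
     (rule inj_on_subset[OF inj_on_reduce_add set_position_pmf] finite_ent_position assms)+

lemma H_mono: "0 \<le> s \<Longrightarrow> s \<le> t \<Longrightarrow> H w L s \<le> H w L t"
  using H_mono_add[of s "t - s" w L] by simp

lemma H_add_le:
  assumes "0 \<le> s" "0 \<le> t"
  shows "H w L (s + t) \<le> H w L s + H w L t"
  unfolding H_eq_ent position_pmf_add[OF assms]
    ent_pair(2)[OF finite_ent_position[OF assms(1)] finite_ent_position[OF assms(2)], symmetric]
  by (rule ent_map_le(2)[OF ent_pair(1)]) (rule finite_ent_position assms)+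

lemma one_in_jump: "1 \<in> set_pmf (jump_pmf w)"
  by (cases w) auto

lemma position_support:
  assumes "0 < s"
  shows "int n \<in> set_pmf (position_pmf w \<infinity> s)"
proof -
  have "int n \<in> set_pmf (steps_pmf w \<infinity> n)"
  proof (induction n)
    case (Suc n)
    have "int (Suc n) = int n + 1" by simp
    then show ?case
      using Suc one_in_jump[of w] by (auto intro!: bexI[of _ "int n"])
  qed simp
  then show ?thesis
    using assms by (auto simp: position_pmf_def num_jumps_pmf_def)
qed

text \<open>
  If the entropy did not grow, the equality case of \<open>ent_combine_ge\<close> with second arguments \<open>0\<close> and
  \<open>1\<close> would make the law at time \<open>s\<close> constant along \<open>0, 1, 2, \<dots>\<close>, which all carry positive
  mass. A probability distribution cannot have infinitely many atoms of equal mass.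
\<close>

lemma H_strict_mono_pos:
  assumes "0 < s" "s < t"
  shows "H w \<infinity> s < H w \<infinity> t"
proof (rule ccontr)
  define p where "p = position_pmf w \<infinity> s"
  define q where "q = position_pmf w \<infinity> (t - s)"
  have r: "position_pmf w \<infinity> t = sum_pmf p q"
    using position_pmf_add_infinity[of s "t - s" w] assms by (simp add: p_def q_def)
  have supp: "int n \<in> set_pmf p" "int n \<in> set_pmf q" for n
    using position_support assms by (simp_all add: p_def q_def)
  assume "\<not> H w \<infinity> s < H w \<infinity> t"
  then have "H w \<infinity> t = H w \<infinity> s"
    using H_mono[of s t w \<infinity>] assms by simp
  then have ent_eq: "ent (sum_pmf p q) = ent p"
    unfolding H_eq_ent r p_def[symmetric] .
  have fin: "finite_ent p" "finite_ent q"
    unfolding p_def q_def by (rule finite_ent_position, use assms in simp)+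
  have eq: "pmf (sum_pmf p q) (int m + int n) = pmf p (int m)" for m n
    by (rule ent_combine_ge(2)[where f = "(+)", OF _ fin ent_eq supp(1) supp(2)]) simp
  have const: "pmf p (int n) = pmf p 0" for n
    using eq[of n 0] eq[of 0 n] by simp
  have "0 < pmf p 0"
    using supp(1)[of 0] by (simp add: pmf_positive)
  then obtain N where N: "1 < real N * pmf p 0"
    using reals_Archimedean3 by blast
  have "real N * pmf p 0 = measure_pmf.prob p (int ` {..<N})"
    by (simp add: measure_measure_pmf_finite sum.reindex const)
  then show False
    using N measure_pmf.prob_le_1[of p "int ` {..<N}"] by simp
qed

lemma H_strict_mono:
  assumes "0 \<le> s" "s < t"
  shows "H w \<infinity> s < H w \<infinity> t"
proof (cases "s = 0")
  case True
  then show ?thesis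
    \<comment> \<open>at time \<open>0\<close> the support is a single point; comparison with time \<open>t / 2\<close> avoids this case\<close>
    using H_mono[of 0 "t / 2" w \<infinity>] H_strict_mono_pos[of "t / 2" t w] assms by simp
qed (use assms H_strict_mono_pos in auto)

lemma H_tendsto_0: "(H w L \<longlongrightarrow> 0) (at_right 0)"
proof -
  obtain C where C: "0 \<le> C" "\<And>w s. \<lbrakk>0 < s; s \<le> 1\<rbrakk> \<Longrightarrow> H w \<infinity> s \<le> s * ln (1 / s) + C * s"
    using H_upper by blast
  have lim: "((\<lambda>s :: real. s * ln (1 / s) + C * s) \<longlongrightarrow> 0) (at_right 0)"
    by real_asymp
  have ev: "\<forall>\<^sub>F s :: real in at_right 0. 0 < s \<and> s < 1"
    using eventually_at_right_real[of 0 "1 :: real"] by simp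
  show ?thesis
  proof (rule tendsto_sandwich[OF _ _ tendsto_const lim])
    show "\<forall>\<^sub>F s in at_right 0. 0 \<le> H w L s"
      by (intro always_eventually allI) (use ent_nonneg in \<open>simp add: H_eq_ent\<close>)
    show "\<forall>\<^sub>F s in at_right 0. H w L s \<le> s * ln (1 / s) + C * s"
      using ev
    proof eventually_elim
      case (elim s)
      then show ?case
        using H_le_infinity[of s w L] C(2)[of s w] by simp
    qed
  qed
qed

text \<open>
  Monotonicity and subadditivity give \<open>0 \<le> H (s + t) - H s \<le> H t\<close>, so that continuity at \<open>0\<close>
  is enough.
\<close>

lemma H_continuous: "continuous_on {0..} (H w L)"
  unfolding continuous_on_iff
proof (intro ballI allI impI)
  fix s e :: real
  assume s: "s \<in> {0..}" and e: "0 < e"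
  have "\<forall>\<^sub>F t in at_right 0. H w L t < e"
    using H_tendsto_0 e by (rule order_tendstoD)
  then obtain d where d: "0 < d" "\<And>t. 0 < t \<Longrightarrow> t < d \<Longrightarrow> H w L t < e"
    by (auto simp: eventually_at_right[of 0 1])
  have *: "\<bar>H w L v - H w L u\<bar> < e" if "0 \<le> u" "u \<le> v" "v - u < d" for u v
    using that H_mono[of u v w L] H_add_le[of u "v - u" w L] d(2)[of "v - u"] e
    by (cases "u = v") auto
  show "\<exists>d>0. \<forall>t\<in>{0..}. dist t s < d \<longrightarrow> dist (H w L t) (H w L s) < e"
  proof (intro exI[of _ d] conjI ballI impI)
    fix t assume "t \<in> {0..}" "dist t s < d"
    then show "dist (H w L t) (H w L s) < e"
      using *[of s t] *[of t s] s by (cases "s \<le> t") (auto simp: dist_real_def abs_minus_commute)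
  qed (fact d(1))
qed

text \<open>
  Every atom away from the origin has mass at most the probability \<open>P \<le> s\<close> of having moved, hence
  surprisal at least \<open>ln (1 / s)\<close>; and \<open>P \<ge> s exp (- s)\<close>, because for \<open>L \<ge> 2\<close> a single jump
  always leads away from the origin.
\<close>

lemma H_lower:
  assumes s: "0 < s" "s < 1" and L: "2 \<le> L"
  shows "s * exp (- s) * ln (1 / s) \<le> H w L s"
proof -
  define P where "P = measure_pmf.prob (position_pmf w L s) {x. x \<noteq> 0}"
  have "P \<le> s"
  proof -
    have "P \<le> measure_pmf.prob (position_pmf w \<infinity> s) {x. x \<noteq> 0}"
      unfolding P_def
      by (subst position_pmf_reduce)
         (auto intro!: measure_pmf.finite_measure_mono)
    also have "\<dots> = measure_pmf.expectation (position_pmf w \<infinity> s) (indicator {x. x \<noteq> 0})"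
      by simp
    also have "\<dots> \<le> measure_pmf.expectation (position_pmf w \<infinity> s) (\<lambda>x. real_of_int \<bar>x\<bar>)"
      by (rule integral_mono[OF _ position_abs_mean(1)]) (use s in \<open>auto intro!: measure_pmf.integrable_const_bound[where B = 1] split: split_indicator\<close>)
    finally show ?thesis
      using position_abs_mean(2)[of s w] s by simp
  qed
  have nz: "0 \<notin> set_pmf (steps_pmf w L 1)"
    using L by (cases L; cases w) (auto simp: numeral_eq_enat zmod_minus1)
  have "s * exp (- s) \<le> P"
  proof -
    have "ennreal (s * exp (- s)) = emeasure (measure_pmf (num_jumps_pmf s)) {1}"
      using s by (simp add: emeasure_pmf_single num_jumps_pmf_def)
    also have "\<dots> = (\<integral>\<^sup>+ n. indicator {1} n \<partial>measure_pmf (num_jumps_pmf s))"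
      by simp
    also have "\<dots> \<le> (\<integral>\<^sup>+ n. emeasure (measure_pmf (steps_pmf w L n)) {x. x \<noteq> 0} \<partial>measure_pmf (num_jumps_pmf s))"
    proof (rule nn_integral_mono)
      fix n
      have "emeasure (measure_pmf (steps_pmf w L 1)) {x. x \<noteq> 0} = 1"
        using nz by (subst measure_pmf.emeasure_eq_1_AE) (auto simp: AE_measure_pmf_iff simp del: steps_pmf.simps One_nat_def)
      then show "indicator {1} n \<le> emeasure (measure_pmf (steps_pmf w L n)) {x. x \<noteq> 0}"
        by (auto split: split_indicator simp del: steps_pmf.simps)
    qed
    also have "\<dots> = emeasure (measure_pmf (position_pmf w L s)) {x. x \<noteq> 0}"
      by (simp add: position_pmf_def)
    also have "\<dots> = ennreal P"
      by (simp add: P_def measure_pmf.emeasure_eq_measure)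
    finally show ?thesis
      by (simp add: P_def)
  qed
  have "s * exp (- s) * ln (1 / s) \<le> P * ln (1 / s)"
    using \<open>s * exp (- s) \<le> P\<close> s by (intro mult_right_mono) auto
  also have "\<dots> = measure_pmf.expectation (position_pmf w L s) (\<lambda>x. indicator {x. x \<noteq> 0} x * ln (1 / s))"
    by (simp add: P_def)
  also have "\<dots> \<le> ent (position_pmf w L s)"
  proof (rule integral_mono_AE[OF _ finite_ent_position])
    show "AE x in measure_pmf (position_pmf w L s).
        indicator {x. x \<noteq> 0} x * ln (1 / s) \<le> - ln (pmf (position_pmf w L s) x)"
      unfolding AE_measure_pmf_iff
    proof
      fix x assume x: "x \<in> set_pmf (position_pmf w L s)"
      show "indicator {x. x \<noteq> 0} x * ln (1 / s) \<le> - ln (pmf (position_pmf w L s) x)"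
      proof (cases "x = 0")
        case False
        have "pmf (position_pmf w L s) x \<le> P"
          unfolding P_def pmf.rep_eq using False by (intro measure_pmf.finite_measure_mono) auto
        then have "ln (pmf (position_pmf w L s) x) \<le> ln s"
          using \<open>P \<le> s\<close> pmf_positive[OF x] by simp
        then show ?thesis
          using False s by (simp add: ln_div)
      qed (use ln_pmf_nonpos in simp)
    qed
  qed (use s in \<open>auto intro!: measure_pmf.integrable_const_bound[where B = 1]\<close>)
  finally show ?thesis
    by (simp add: H_eq_ent)
qed

text \<open>
  Both entropies are expectations under the law on \<open>\<int>\<close>: for \<open>H\<^sub>n\<close>, of the surprisal of the residue
  class of \<open>x\<close> modulo \<open>n\<close>. For fixed \<open>x\<close> the mass of this class tends to that of \<open>x\<close> itself, and the
  surprisal of \<open>x\<close> is an integrable majorant.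
\<close>

lemma H_finite_tendsto:
  assumes "0 \<le> s"
  shows "(\<lambda>n. H w (enat n) s) \<longlonglongrightarrow> H w \<infinity> s"
proof -
  define p where "p = position_pmf w \<infinity> s"
  define u where "u n x = pmf (position_pmf w (enat n) s) (reduce (enat n) x)" for n x
  have u: "u n x = pmf (map_pmf (reduce (enat n)) p) (reduce (enat n) x)" for n x
    unfolding u_def p_def by (subst position_pmf_reduce) simp
  have H_u: "H w (enat n) s = measure_pmf.expectation p (\<lambda>x. - ln (u n x))" for n
    unfolding H_eq_ent u by (subst (1 2) position_pmf_reduce) (simp add: p_def)
  have fin: "finite_ent p"
    using finite_ent_position[OF assms] by (simp add: p_def)
  have u_lim: "(\<lambda>n. u n x) \<longlonglongrightarrow> pmf p x" for x
  proof -
    have "(\<lambda>n. measure_pmf.expectation p (indicator (reduce (enat n) -` {reduce (enat n) x}) :: int \<Rightarrow> real))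
        \<longlonglongrightarrow> measure_pmf.expectation p (indicator {x})"
    proof (rule integral_dominated_convergence[where w = "\<lambda>_. 1"])
      show "AE y in measure_pmf p. (\<lambda>n. indicator (reduce (enat n) -` {reduce (enat n) x}) y :: real)
          \<longlonglongrightarrow> indicator {x} y"
      proof (intro AE_I2 tendsto_eventually)
        fix y
        have "\<forall>\<^sub>F n in sequentially. nat \<bar>y - x\<bar> < n"
          by (rule eventually_gt_at_top)
        then show "\<forall>\<^sub>F n in sequentially. (indicator (reduce (enat n) -` {reduce (enat n) x}) y :: real)
            = indicator {x} y"
        proof eventually_elim
          case (elim n)
          have "y = x" if "y mod int n = x mod int n"
            using that elim dvd_imp_le_int[of "y - x" "int n"] by (force simp: mod_eq_dvd_iff)
          then show ?case
            by (auto split: split_indicator)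
        qed
      qed
    qed (auto split: split_indicator)
    then show ?thesis
      by (simp add: u pmf_map pmf.rep_eq)
  qed
  have "(\<lambda>n. measure_pmf.expectation p (\<lambda>x. - ln (u n x))) \<longlonglongrightarrow> ent p"
  proof (rule integral_dominated_convergence[OF _ _ fin])
    show "AE x in measure_pmf p. (\<lambda>n. - ln (u n x)) \<longlonglongrightarrow> - ln (pmf p x)"
      unfolding AE_measure_pmf_iff
      by (intro ballI tendsto_minus tendsto_ln u_lim) (simp add: set_pmf_iff)
    show "AE x in measure_pmf p. norm (- ln (u n x)) \<le> - ln (pmf p x)" for n
      unfolding AE_measure_pmf_iff
    proof
      fix x assume "x \<in> set_pmf p"
      then show "norm (- ln (u n x)) \<le> - ln (pmf p x)"
        using ln_pmf_le_ln_pmf_map[of x p "reduce (enat n)"]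
          ln_pmf_nonpos[of "map_pmf (reduce (enat n)) p" "reduce (enat n) x"]
        by (simp add: u)
    qed
  qed auto
  then show ?thesis
    unfolding H_u by (simp add: H_eq_ent p_def)
qed

section \<open>Inverting the entropy at small values\<close>

lemma H_inv:
  assumes "0 \<le> y" "0 \<le> a" "y < H w L a"
  defines "s \<equiv> inv_into {0..} (H w L) y"
  shows "H w L s = y" and "0 \<le> s" and "s < a"
proof -
  have "\<exists>x\<ge>0. x \<le> a \<and> H w L x = y"
    using assms by (intro IVT') (auto intro: continuous_on_subset[OF H_continuous])
  then have y: "y \<in> H w L ` {0..}" by force
  from f_inv_into_f[OF y] inv_into_into[OF y] show "H w L s = y" "0 \<le> s"
    by (simp_all add: s_def)
  then show "s < a"
    using H_mono[of a s w L] assms(2,3) by linarith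
qed

text \<open>
  The leading-order inverse of \<open>s \<mapsto> s ln (1 / s)\<close> near \<open>0\<close>.
\<close>

definition small_time :: "real \<Rightarrow> real" where
  "small_time y = y / ln (1 / y)"

lemma at_right_0_less_1: "\<forall>\<^sub>F y :: real in at_right 0. 0 < y \<and> y < 1"
  using eventually_at_right_real[of 0 "1 :: real"] by simp

lemma H_gt_eventually:
  assumes "0 < e"
  shows "\<forall>\<^sub>F y in at_right 0. \<forall>w L. 2 \<le> L \<longrightarrow> y < H w L ((1 + e) * small_time y)"
proof -
  define c where "c = 1 + e"
  have c: "1 < c" "0 < c" using assms by (simp_all add: c_def)
  have "((\<lambda>y. c * small_time y) \<longlongrightarrow> 0) (at_right 0)"
    unfolding small_time_def using c by real_asymp
  then have small: "\<forall>\<^sub>F y in at_right 0. c * small_time y < 1"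
    by (rule order_tendstoD) simp
  have "((\<lambda>y. (c * small_time y * exp (- (c * small_time y)) * ln (1 / (c * small_time y))) / y) \<longlongrightarrow> c) (at_right 0)"
    unfolding small_time_def using c by real_asymp
  then have "\<forall>\<^sub>F y in at_right 0. 1 < (c * small_time y * exp (- (c * small_time y)) * ln (1 / (c * small_time y))) / y"
    using c(1) by (rule order_tendstoD)
  then show ?thesis
    using small at_right_0_less_1
  proof eventually_elim
    case (elim y)
    have "0 < c * small_time y"
      using elim c by (simp add: small_time_def)
    then have "y < H w L (c * small_time y)" if "2 \<le> L" for w L
      using H_lower[of "c * small_time y" L w] elim that by (simp add: less_divide_eq)
    then show ?case by (simp add: c_def)
  qed
qed

lemma H_le_eventually:
  assumes "0 < e" "e < 1"
  shows "\<forall>\<^sub>F y in at_right 0. \<forall>w. H w \<infinity> ((1 - e) * small_time y) \<le> y"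
proof -
  obtain C where C: "0 \<le> C" "\<And>w s. \<lbrakk>0 < s; s \<le> 1\<rbrakk> \<Longrightarrow> H w \<infinity> s \<le> s * ln (1 / s) + C * s"
    using H_upper by blast
  define c where "c = 1 - e"
  have c: "c < 1" "0 < c" using assms by (simp_all add: c_def)
  have "((\<lambda>y. c * small_time y) \<longlongrightarrow> 0) (at_right 0)"
    unfolding small_time_def using c by real_asymp
  then have small: "\<forall>\<^sub>F y in at_right 0. c * small_time y < 1"
    by (rule order_tendstoD) simp
  have "((\<lambda>y. (c * small_time y * ln (1 / (c * small_time y)) + C * (c * small_time y)) / y) \<longlongrightarrow> c) (at_right 0)"
    unfolding small_time_def using c by real_asymp
  then have "\<forall>\<^sub>F y in at_right 0. (c * small_time y * ln (1 / (c * small_time y)) + C * (c * small_time y)) / y < 1"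
    using c(1) by (rule order_tendstoD)
  then show ?thesis
    using small at_right_0_less_1
  proof eventually_elim
    case (elim y)
    have "0 < c * small_time y"
      using elim c by (simp add: small_time_def)
    then have "H w \<infinity> (c * small_time y) \<le> y" for w
      using C(2)[of "c * small_time y" w] elim by (simp add: divide_less_eq)
    then show ?case by (simp add: c_def)
  qed
qed

section \<open>Entropic times of the quotients\<close>

lemma (in comm_group) subgroup_multiples: "subgroup (multiples G L) G"
proof (rule subgroupI)
  show "multiples G L \<noteq> {}"
    by (auto simp: multiples_def)
  fix a assume "a \<in> multiples G L"
  then obtain x where x: "x \<in> carrier G" "a = x [^] L"
    by (auto simp: multiples_def)
  then have "inv a = (inv x) [^] L"
    by (simp add: nat_pow_inv)
  then show "inv a \<in> multiples G L"
    using x by (auto simp: multiples_def)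
  fix b assume "b \<in> multiples G L"
  then obtain y where y: "y \<in> carrier G" "b = y [^] L"
    by (auto simp: multiples_def)
  then have "a \<otimes> b = (x \<otimes> y) [^] L"
    using x by (simp add: nat_pow_distrib)
  then show "a \<otimes> b \<in> multiples G L"
    using x y by (auto simp: multiples_def)
qed (auto simp: multiples_def)

lemma (in comm_group) order_Mod_multiples:
  assumes "finite (carrier G)"
  shows "1 \<le> order (G Mod multiples G L)" "order (G Mod multiples G L) \<le> order G"
    and "order (G Mod multiples G (order G)) = order G"
proof -
  have lag: "order (G Mod multiples G L) * card (multiples G L) = order G" for L
    using lagrange[OF subgroup_multiples] by (simp add: FactGroup_def order_def)
  have pos: "0 < order G"
    using assms by (simp add: order_gt_0_iff_finite)
  show "1 \<le> order (G Mod multiples G L)"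
    using lag[of L] pos by (cases "order (G Mod multiples G L)") auto
  show "order (G Mod multiples G L) \<le> order G"
    using lag[of L] pos by (intro dvd_imp_le) (auto intro: dvdI[of _ _ "card (multiples G L)"])
  have "multiples G (order G) = {\<one>}"
    by (force simp: multiples_def pow_order_eq_1)
  then show "order (G Mod multiples G (order G)) = order G"
    using lag[of "order G"] by simp
qed

text \<open>
  The times \<open>a\<close> and \<open>b\<close> are one-sided certificates for the entropy level \<open>ln |G| / k\<close>: the entropy
  exceeds it by time \<open>a\<close> for every \<open>L \<ge> 2\<close>, and on \<open>\<int>\<close> it does not exceed it at time \<open>b\<close>.
  Existence of \<open>a\<close> also ensures that the levels in question lie in the range of each \<open>H\<^sub>L\<close>, so
  that \<open>inv_into\<close> returns a genuine preimage.
\<close>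

lemma t0_quotient_bounds:
  fixes G :: "'a monoid"
  assumes G: "comm_group G" "finite (carrier G)"
    and N: "2 \<le> order G" and k: "0 < k"
    and a: "0 \<le> a" "\<And>L. 2 \<le> L \<Longrightarrow> ln (real (order G)) / real k < H w L a"
  shows "1 \<le> L \<Longrightarrow> t0_quotient w k G L \<le> real k * a"
    and "t0 w k \<infinity> (order G) \<le> t0_quotient w k G (order G)"
    and "\<exists>L\<ge>1. \<forall>L'\<ge>1. t0_quotient w k G L' \<le> t0_quotient w k G L"
    and "\<lbrakk>0 \<le> b; H w \<infinity> b \<le> ln (real (order G)) / real k\<rbrakk> \<Longrightarrow> real k * b \<le> t0 w k \<infinity> (order G)"
proof -
  interpret comm_group G by fact
  define y where "y L = ln (real (order (G Mod multiples G L))) / real k" for L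
  define Y where "Y = ln (real (order G)) / real k"
  define s where "s L = inv_into {0..} (H w (enat L)) (y L)" for L
  define S where "S = inv_into {0..} (H w \<infinity>) Y"
  have y: "0 \<le> y L" "y L \<le> Y" for L
    unfolding y_def Y_def using order_Mod_multiples(1,2)[OF G(2), of L] k by (auto intro!: divide_right_mono)
  have y_order: "y (order G) = Y"
    by (simp add: y_def Y_def order_Mod_multiples(3)[OF G(2)])
  have Y: "0 \<le> Y" using N by (simp add: Y_def)
  have t0q: "t0_quotient w k G L = (if L = 1 then 0 else real k * s L)" for L
    by (simp add: t0_quotient_def t0_def s_def y_def one_enat_def)
  have t0: "t0 w k \<infinity> (order G) = real k * S"
    by (simp add: t0_def S_def Y_def)
  have S: "H w \<infinity> S = Y" "0 \<le> S" "S < a"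
    using H_inv[OF Y a(1), of w \<infinity>] a(2)[of \<infinity>] by (simp_all add: S_def Y_def)
  have S_ge: "u \<le> S" if "0 \<le> u" "H w \<infinity> u \<le> Y" for u
    using H_strict_mono[of S u w] S that by linarith
  have s_less: "s L < u" "H w (enat L) (s L) = y L" "0 \<le> s L" if "0 \<le> u" "Y < H w (enat L) u" for L u
    using H_inv[OF y(1)[of L] that(1), of w "enat L"] that(2) y(2)[of L] by (simp_all add: s_def)
  have a': "Y < H w (enat L) a" if "2 \<le> L" for L
    using a(2)[of "enat L"] that by (simp add: Y_def numeral_eq_enat)
  note s = s_less[OF a(1) a']
  show "t0_quotient w k G L \<le> real k * a" if "1 \<le> L" for L
    using s(1)[of L] that k a(1) by (auto simp: t0q)
  show "real k * b \<le> t0 w k \<infinity> (order G)" if "0 \<le> b" "H w \<infinity> b \<le> ln (real (order G)) / real k"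
    using S_ge[of b] that k by (simp add: t0 Y_def)
  have "S \<le> s (order G)"
  proof (rule ccontr)
    assume less: "\<not> S \<le> s (order G)"
    have "Y = H w (enat (order G)) (s (order G))"
      using s(2)[OF N] y_order by simp
    also have "\<dots> \<le> H w \<infinity> (s (order G))"
      using s(3)[OF N] by (rule H_le_infinity)
    also have "\<dots> < H w \<infinity> S"
      using less s(3)[OF N] by (intro H_strict_mono) auto
    finally show False using S(1) by simp
  qed
  then show le: "t0 w k \<infinity> (order G) \<le> t0_quotient w k G (order G)"
    using N k by (simp add: t0 t0q)
  show "\<exists>L\<ge>1. \<forall>L'\<ge>1. t0_quotient w k G L' \<le> t0_quotient w k G L"
  proof (cases "\<exists>L0\<ge>1. t0 w k \<infinity> (order G) < t0_quotient w k G L0")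
    case True
    then obtain L0 where L0: "1 \<le> L0" "t0 w k \<infinity> (order G) < t0_quotient w k G L0" by blast
    moreover have "0 \<le> t0 w k \<infinity> (order G)"
      using S(2) by (simp add: t0)
    ultimately have "L0 \<noteq> 1" by (auto simp: t0q)
    then have less: "S < s L0"
      using L0(2) k by (simp add: t0 t0q)
    have "Y < H w \<infinity> (s L0)"
      using H_strict_mono[OF S(2) less, of w] S(1) by simp
    then have "\<forall>\<^sub>F n in sequentially. Y < H w (enat n) (s L0)"
      using H_finite_tendsto[of "s L0" w] S(2) less by (intro order_tendstoD) auto
    then obtain M where M: "\<And>n. M \<le> n \<Longrightarrow> Y < H w (enat n) (s L0)"
      by (auto simp: eventually_sequentially)
    \<comment> \<open>on \<open>\<int>\<^sub>L\<close> with \<open>L\<close> large, the level \<open>Y\<close> is already passed at the time attained for \<open>L0\<close>\<close>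
    have tail: "t0_quotient w k G L \<le> t0_quotient w k G L0" if "max M 2 \<le> L" for L
      using s_less(1)[of "s L0" L] M[of L] that S(2) less k \<open>L0 \<noteq> 1\<close> by (auto simp: t0q)
    define F where "F = insert L0 {1..<max M 2}"
    have "finite F" "F \<noteq> {}" by (auto simp: F_def)
    then have "Max (t0_quotient w k G ` F) \<in> t0_quotient w k G ` F"
      by (intro Max_in) auto
    then obtain L where L: "L \<in> F" "Max (t0_quotient w k G ` F) = t0_quotient w k G L"
      by auto
    have L_max: "t0_quotient w k G L' \<le> t0_quotient w k G L" if "L' \<in> F" for L'
      using that \<open>finite F\<close> by (simp add: L(2)[symmetric])
    show ?thesis
    proof (intro exI[of _ L] conjI allI impI)
      show "1 \<le> L" using L(1) L0(1) by (auto simp: F_def)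
      fix L' :: nat assume "1 \<le> L'"
      then show "t0_quotient w k G L' \<le> t0_quotient w k G L"
        using L_max[of L'] order_trans[OF tail[of L'] L_max[of L0]]
        by (cases "max M 2 \<le> L'") (simp_all add: F_def)
    qed
  next
    case False
    then show ?thesis
      using le N by (intro exI[of _ "order G"]) (fastforce simp: not_less)
  qed
qed

section \<open>Asymptotics\<close>

lemma asymp_equiv_relative_error:
  fixes f g :: "'b \<Rightarrow> real"
  assumes pos: "\<forall>\<^sub>F x in F. 0 < g x"
    and bound: "\<And>e. \<lbrakk>0 < e; e < 1\<rbrakk> \<Longrightarrow> \<forall>\<^sub>F x in F. (1 - e) * g x \<le> f x \<and> f x \<le> (1 + e) * g x"
  shows "f \<sim>[F] g"
proof (rule asymp_equivI', rule tendstoI)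
  fix e :: real assume "0 < e"
  define d where "d = min (e / 2) (1 / 2)"
  have d: "0 < d" "d < 1" "d < e" using \<open>0 < e\<close> by (auto simp: d_def min_def)
  show "\<forall>\<^sub>F x in F. dist (f x / g x) 1 < e"
    using bound[OF d(1,2)] pos
  proof eventually_elim
    case (elim x)
    then have "1 - d \<le> f x / g x" "f x / g x \<le> 1 + d"
      by (simp_all add: field_simps)
    then show ?case using d(3) by (simp add: dist_real_def abs_less_iff)
  qed
qed

theorem propositionB19:
  fixes w :: walk
    and G :: "nat \<Rightarrow> 'a monoid"
    and k :: "nat \<Rightarrow> nat"
    and \<rho> :: "nat \<Rightarrow> real"
  assumes "\<And>n. comm_group (G n)"
    and "\<And>n. finite (carrier (G n))"
    and "filterlim (\<lambda>n. order (G n)) at_top sequentially"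
    and "(\<lambda>n. ln (real (order (G n)))) \<in> o(\<lambda>n. real (k n))"
    and "\<And>n. \<rho> n = ln (real (k n)) / ln (ln (real (order (G n))))"
  shows "(\<forall>\<^sub>F n in sequentially. \<exists>L\<ge>1. \<forall>L'\<ge>1.
            t0_quotient w (k n) (G n) L' \<le> t0_quotient w (k n) (G n) L)
       \<and> (\<lambda>n. SUP L\<in>{1..}. t0_quotient w (k n) (G n) L)
            \<sim>[sequentially] (\<lambda>n. t0 w (k n) \<infinity> (order (G n)))
       \<and> (\<lambda>n. t0 w (k n) \<infinity> (order (G n)))
            \<sim>[sequentially] (\<lambda>n. \<rho> n / (\<rho> n - 1) * log (real (k n)) (real (order (G n))))
       \<and> (\<forall>\<^sub>F n in sequentially.
            \<rho> n / (\<rho> n - 1) * log (real (k n)) (real (order (G n)))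
              = ln (real (order (G n))) / ln (real (k n) / ln (real (order (G n)))))"
proof -
  define N where "N n = order (G n)" for n
  define y where "y n = ln (real (N n)) / real (k n)" for n
  \<comment> \<open>equals \<open>ln N / ln (k / ln N)\<close>\<close>
  define target where "target n = real (k n) * small_time (y n)" for n
  define T where "T n = t0 w (k n) \<infinity> (N n)" for n
  define M where "M n = (SUP L\<in>{1..}. t0_quotient w (k n) (G n) L)" for n
  have N_lim: "filterlim (\<lambda>n. real (N n)) at_top sequentially"
    unfolding N_def using assms(3) by (rule filterlim_compose[OF filterlim_real_sequentially])
  have N_large: "\<forall>\<^sub>F n in sequentially. exp 1 < real (N n)"
    using N_lim by (simp add: filterlim_at_top_dense)
  have ln_N: "1 < ln (real (N n))" "2 \<le> N n" if "exp 1 < real (N n)" for n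
  proof -
    have N1: "1 < real (N n)"
      using that one_less_exp_iff[of 1] by linarith
    then show "2 \<le> N n" by linarith
    show "1 < ln (real (N n))"
      using that N1 by (subst ln_exp[of 1, symmetric], subst ln_less_cancel_iff) auto
  qed
  have k_pos: "\<forall>\<^sub>F n in sequentially. ln (real (N n)) < real (k n)"
    using landau_o.smallD[OF assms(4) half_gt_zero[OF zero_less_one]] N_large
  proof eventually_elim
    case (elim n)
    then show ?case using ln_N(1)[of n] by (simp add: N_def)
  qed
  have y_lim: "filterlim y (at_right 0) sequentially"
  proof -
    have "y \<longlonglongrightarrow> 0"
      using smalloD_tendsto[OF assms(4)] by (simp add: y_def[abs_def] N_def)
    moreover have "\<forall>\<^sub>F n in sequentially. y n \<in> {0<..} \<and> y n \<noteq> 0"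
      using N_large k_pos by eventually_elim (use ln_N in \<open>force simp: y_def\<close>)
    ultimately show ?thesis by (simp add: filterlim_at)
  qed
  note at_y = eventually_compose_filterlim[OF _ y_lim]
  have target_pos: "\<forall>\<^sub>F n in sequentially. 0 < target n"
    using at_y[OF at_right_0_less_1] N_large k_pos
    by eventually_elim (use ln_N in \<open>force simp: target_def small_time_def\<close>)

  have key: "\<forall>\<^sub>F n in sequentially. (1 - e) * target n \<le> T n \<and> T n \<le> M n \<and> M n \<le> (1 + e) * target n
      \<and> (\<exists>L\<ge>1. \<forall>L'\<ge>1. t0_quotient w (k n) (G n) L' \<le> t0_quotient w (k n) (G n) L)"
    if e: "0 < e" "e < 1" for e
    using at_y[OF H_gt_eventually[OF e(1)]] at_y[OF H_le_eventually[OF e]] at_y[OF at_right_0_less_1]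
      N_large k_pos
  proof eventually_elim
    case (elim n)
    have N2: "2 \<le> order (G n)" and k: "0 < k n"
      using ln_N[OF elim(4)] elim(5) by (simp_all add: N_def)
    have scale_pos: "0 < small_time (y n)"
      using elim(3) by (simp add: small_time_def)
    have a: "0 \<le> (1 + e) * small_time (y n)" and b: "0 \<le> (1 - e) * small_time (y n)"
      using scale_pos e by simp_all
    have gt: "ln (real (order (G n))) / real (k n) < H w L ((1 + e) * small_time (y n))" if "2 \<le> L" for L
      using elim(1) that by (simp add: y_def N_def)
    note B = t0_quotient_bounds[OF assms(1,2) N2 k a gt]
    have bdd: "bdd_above (t0_quotient w (k n) (G n) ` {1..})"
      using B(1) by (auto intro!: bdd_aboveI2)
    have "(1 - e) * target n \<le> T n"
      using B(4)[OF _ b] elim(2) by (simp add: T_def target_def y_def N_def mult.left_commute)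
    moreover have "T n \<le> M n"
      using B(2) N2 cSUP_upper[OF _ bdd, of "order (G n)"] by (simp add: T_def M_def N_def)
    moreover have "M n \<le> (1 + e) * target n"
      unfolding M_def by (rule cSUP_least) (use B(1) in \<open>auto simp: target_def mult.left_commute\<close>)
    ultimately show ?case
      using B(3) by blast
  qed
  have T_target: "T \<sim>[sequentially] target"
  proof (rule asymp_equiv_relative_error[OF target_pos])
    fix e :: real assume "0 < e" "e < 1"
    from key[OF this] show "\<forall>\<^sub>F n in sequentially. (1 - e) * target n \<le> T n \<and> T n \<le> (1 + e) * target n"
      by eventually_elim auto
  qed
  have M_target: "M \<sim>[sequentially] target"
  proof (rule asymp_equiv_relative_error[OF target_pos])
    fix e :: real assume "0 < e" "e < 1"
    from key[OF this] show "\<forall>\<^sub>F n in sequentially. (1 - e) * target n \<le> M n \<and> M n \<le> (1 + e) * target n"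
      by eventually_elim auto
  qed
  have target_eq: "\<forall>\<^sub>F n in sequentially. target n = ln (real (N n)) / ln (real (k n) / ln (real (N n)))"
    using k_pos N_large
    by eventually_elim (use ln_N in \<open>force simp: target_def small_time_def y_def\<close>)
  have rho_eq: "\<forall>\<^sub>F n in sequentially. \<rho> n / (\<rho> n - 1) * log (real (k n)) (real (N n))
      = ln (real (N n)) / ln (real (k n) / ln (real (N n)))"
    using k_pos N_large
  proof eventually_elim
    case (elim n)
    define l where "l = ln (ln (real (N n)))"
    define K where "K = ln (real (k n))"
    have pos: "0 < ln (real (N n))" "0 < real (k n)" "0 < l"
      using ln_N(1)[OF elim(2)] elim(1) by (simp_all add: l_def)
    have "l < K"
      unfolding l_def K_def using elim(1) pos by (subst ln_less_cancel_iff) auto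
    have "\<rho> n = K / l"
      using assms(5)[of n] by (simp add: K_def l_def N_def)
    then have "\<rho> n / (\<rho> n - 1) = (K / l) / ((K - l) / l)"
      using pos by (simp add: diff_divide_distrib)
    then have "\<rho> n / (\<rho> n - 1) = K / (K - l)"
      using pos by simp
    moreover have "ln (real (k n) / ln (real (N n))) = K - l"
      using pos by (simp add: K_def l_def ln_div)
    ultimately show ?case
      using \<open>l < K\<close> pos by (simp add: log_def K_def[symmetric])
  qed
  have "\<forall>\<^sub>F n in sequentially. target n = \<rho> n / (\<rho> n - 1) * log (real (k n)) (real (N n))"
    using target_eq rho_eq by eventually_elim simp
  then have "target \<sim>[sequentially] (\<lambda>n. \<rho> n / (\<rho> n - 1) * log (real (k n)) (real (N n)))"
    by (rule asymp_equiv_refl_ev)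
  with T_target have "T \<sim>[sequentially] (\<lambda>n. \<rho> n / (\<rho> n - 1) * log (real (k n)) (real (N n)))"
    by (rule asymp_equiv_trans)
  moreover have "M \<sim>[sequentially] T"
    using M_target asymp_equiv_symI[OF T_target] by (rule asymp_equiv_trans)
  moreover have "\<forall>\<^sub>F n in sequentially. \<exists>L\<ge>1. \<forall>L'\<ge>1.
      t0_quotient w (k n) (G n) L' \<le> t0_quotient w (k n) (G n) L"
    using key[of "1/2"] by (auto elim: eventually_mono)
  ultimately show ?thesis
    using rho_eq unfolding T_def[abs_def] M_def[abs_def] N_def by blast
qed

end
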